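(* Let $\Pi=(\Lambda,X,f)$ be an instance of a linear-$p$-parametric minimization problem satisfying the standing assumptions of the context, where $\Lambda$ is a polytope. For every $\varepsilon\geq 0$ and every $\alpha\geq 1$, Algorithm 1 (described in the context), run on input $(\Pi,\varepsilon)$ with an $\alpha$-approximation oracle $\mathsf{Alg}_\alpha$, computes a $(1+\varepsilon)\alpha$-approximation set for $\Pi$.
   Context: **Problem.** Fix $p\in\mathbb{N}_{>0}$. A linear-$p$-parametric minimization problem is a set of instances $\Pi=(\Lambda,X,f)$, where $\Lambda=\{\lambda\in\mathbb{R}^p: Q\lambda\geq d\}$ with $m\in\mathbb{N}_{>0}$, $Q\in\mathbb{Q}^{m\times p}$, $d\in\mathbb{Q}^m$; $X$ is a set (of feasible solutions); and $f=(f_1,\ldots,f_{p+1})^{\mathsf T}:X\to\mathbb{R}^{p+1}$. The sets/functions $X,f$ may be encoded implicitly; $\langle\cdot\rangle$ denotes binary encoding length. Let $F_\lambda(x)=\sum_{i=1}^p\lambda_i f_i(x)+f_{p+1}(x)$; for $\lambda\in\Lambda$, $\Pi(\lambda)$ is the non-parametric problem $\min_{x\in X}F_\lambda(x)$ with optimal value $F^*(\lambda)$. For $\beta\ge 1$, a $\beta$-approximation set is a set $S\subseteq X$ such that for every $\lambda\in\Lambda$ there is $x\in S$ with $F_\lambda(x)\leq\beta F^*(\lambda)$ (for $\beta=1$ this is an optimal solution set). **Standing assumptions.** (a) $f$ is polynomial-time computable, every $\Pi(\lambda)$, $\lambda\in\Lambda$, is bounded, and there is a polynomial bound (depending only on the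 parametric problem) such that every $\Pi(\lambda)$ has an optimal solution of encoding length bounded by this polynomial in $\langle\Pi\rangle$. $X_{\mathrm{pol}}\subseteq X$ denotes the (finite) set of all solutions with encoding length bounded by such a (fixed) polynomial in $\langle\Pi\rangle$; so each $\Pi(\lambda)$ has an optimal solution in $X_{\mathrm{pol}}$. (b) $p$ is a constant, $\Lambda$ is $p$-dimensional, and $Q\lambda\geq d$ contains no redundant inequalities. (c) If an approximation factor larger than $1$ is considered (i.e. $(1+\varepsilon)\alpha>1$), then $F_\lambda(x)\geq0$ for all $\lambda\in\Lambda$, $x\in X$. (d) An $\alpha$-approximation oracle $\mathsf{Alg}_\alpha$ is available: on input $\lambda\in\Lambda$ it returns some $x\in X_{\mathrm{pol}}$ with $F_\lambda(x)\leq\alpha F^*(\lambda)$. **Polyhedra.** For $x\in X$ let $h(x)=\{(\lambda,z)\in\mathbb{R}^{p+1}: z=F_\lambda(x)\}$ and $H(x)=\{(\lambda,z)\in\mathbb{R}^{p+1}: z\leq F_\lambda(x)\}$. For $S\subseteq X$ let $\mathcal{A}(S)=\bigcap_{x\in S}H(x)\cap(\Lambda\times\mathbb{R})$. $\mathsf{vert}(\cdot)$ denotes the vertex set. **Algorithm 1** (input: $\Pi$, $\varepsilon\geq0$). 1. Choose an arbitrary $\lambda^0\in\Lambda$. 2. $V\gets\{\lambda^0\}$. 3. $x^0\gets\mathsf{Alg}_\alpha(\lambda^0)$. 4. $S\gets\{x^0\}$. 5. Compute $\mathsf{vert}(\mathcal{A}(S))$. 6. For each $(\lambda,z)\in\mathsf{vert}(\mathcal{A}(S))$: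 7. if $\lambda\notin V$: 8. $V\gets V\cup\{\lambda\}$; 9. $x\gets\mathsf{Alg}_\alpha(\lambda)$; 10. if $(1+\varepsilon)F_\lambda(x)<z$: 11. $S\gets S\cup\{x\}$, 12. go to Step 5. 13. (When the loop finishes; optional) remove from $S$ redundant solutions, i.e. those $x$ for which $h(x)$ does not contain a facet of $\mathcal{A}(S)$. 14. Return $S$. *)

theory Defs
  imports "HOL-Analysis.Analysis" "HOL-Computational_Algebra.Polynomial"
begin

section \<open>Polynomial-time computability on binary words\<close>

text \<open>
  Deterministic single-tape Turing machines with a two-way infinite tape.  States are
  \<open>0..<tm_states\<close> with initial state \<open>0\<close>; tape symbols are \<open>0..<tm_symbols\<close>, where \<open>0\<close> is the
  blank and \<open>1\<close>, \<open>2\<close> stand for the two bits.  A machine halts when \<open>tm_delta\<close> yields \<open>None\<close>.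
\<close>

record tm =
  tm_states :: nat
  tm_symbols :: nat
  tm_delta :: "nat \<Rightarrow> nat \<Rightarrow> (nat \<times> nat \<times> int) option"

definition wf_tm :: "tm \<Rightarrow> bool" where
  "wf_tm M \<longleftrightarrow> 0 < tm_states M \<and> 3 \<le> tm_symbols M \<and>
     (\<forall>q<tm_states M. \<forall>a<tm_symbols M. \<forall>q' b mv. tm_delta M q a = Some (q', b, mv) \<longrightarrow>
        q' < tm_states M \<and> b < tm_symbols M \<and> mv \<in> {-1, 0, 1})"

text \<open>A configuration consists of the state, the head position and the tape.\<close>

type_synonym tm_config = "nat \<times> int \<times> (int \<Rightarrow> nat)"

definition tm_step :: "tm \<Rightarrow> tm_config \<Rightarrow> tm_config option" where
  "tm_step M = (\<lambda>(q, h, t).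
     map_option (\<lambda>(q', b, mv). (q', h + mv, t(h := b))) (tm_delta M q (t h)))"

definition tape_of :: "bool list \<Rightarrow> int \<Rightarrow> nat" where
  "tape_of w i = (if 0 \<le> i \<and> i < int (length w) then (if w ! nat i then 2 else 1) else 0)"

definition tm_outputs_within :: "tm \<Rightarrow> bool list \<Rightarrow> bool list \<Rightarrow> nat \<Rightarrow> bool" where
  "tm_outputs_within M w v n \<longleftrightarrow>
     (\<exists>k\<le>n. \<exists>q h.
        ((\<lambda>c c'. tm_step M c = Some c') ^^ k) (0, 0, tape_of w) (q, h, tape_of v) \<and>
        tm_step M (q, h, tape_of v) = None)"

definition polytime_computable ::
  "'a set \<Rightarrow> ('a \<Rightarrow> bool list) \<Rightarrow> ('a \<Rightarrow> bool list) \<Rightarrow> bool" where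
  "polytime_computable D inp out \<longleftrightarrow>
     (\<exists>M. wf_tm M \<and> (\<exists>c :: nat poly. \<forall>a\<in>D.
        tm_outputs_within M (inp a) (out a) (poly c (length (inp a)))))"

text \<open>Self-delimiting code for pairs of words: the first word has its bits doubled.\<close>

definition pair_code :: "bool list \<Rightarrow> bool list \<Rightarrow> bool list" where
  "pair_code u v = concat (map (\<lambda>b. [b, b]) u) @ [False, True] @ v"


section \<open>Linear parametric minimization problems\<close>

text \<open>
  The number of parameters \<open>p\<close> is \<open>CARD('p)\<close>.  The \<open>i\<close>-th element of \<open>constraints\<close> is the
  pair of the \<open>i\<close>-th row of the matrix \<open>Q\<close> and the \<open>i\<close>-th entry of \<open>d\<close>.
  The space of dimension \<open>p + 1\<close> is rendered as \<^typ>\<open>(real ^ 'p) \<times> real\<close>;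
  thus \<^term>\<open>fst (objective I x) $ i\<close> are the first \<open>p\<close> components of \<open>f x\<close>, and
  \<^term>\<open>snd (objective I x)\<close> is the last one.
\<close>

record ('x, 'p) inst =
  constraints :: "((rat ^ 'p) \<times> rat) list"
  feasible :: "'x set"
  objective :: "'x \<Rightarrow> (real ^ 'p) \<times> real"

definition satisfies :: "real ^ 'p::finite \<Rightarrow> (rat ^ 'p) \<times> rat \<Rightarrow> bool" where
  "satisfies l c \<longleftrightarrow> (\<Sum>j\<in>UNIV. of_rat (fst c $ j) * l $ j) \<ge> of_rat (snd c)"

definition Lam :: "('x, 'p::finite) inst \<Rightarrow> (real ^ 'p) set" where
  "Lam I = {l. \<forall>i<length (constraints I). satisfies l (constraints I ! i)}"

definition irredundant :: "('x, 'p::finite) inst \<Rightarrow> bool" where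
  "irredundant I \<longleftrightarrow>
     (\<forall>i<length (constraints I).
        {l. \<forall>j<length (constraints I). j \<noteq> i \<longrightarrow> satisfies l (constraints I ! j)} \<noteq> Lam I)"

definition F :: "('x, 'p::finite) inst \<Rightarrow> real ^ 'p \<Rightarrow> 'x \<Rightarrow> real" where
  "F I l x = (\<Sum>i\<in>UNIV. l $ i * fst (objective I x) $ i) + snd (objective I x)"

definition Fopt :: "('x, 'p::finite) inst \<Rightarrow> real ^ 'p \<Rightarrow> real" where
  "Fopt I l = Inf (F I l ` feasible I)"

definition optimal_solution :: "('x, 'p::finite) inst \<Rightarrow> real ^ 'p \<Rightarrow> 'x \<Rightarrow> bool" where
  "optimal_solution I l x \<longleftrightarrow> x \<in> feasible I \<and> (\<forall>y\<in>feasible I. F I l x \<le> F I l y)"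

definition approximation_set :: "('x, 'p::finite) inst \<Rightarrow> real \<Rightarrow> 'x set \<Rightarrow> bool" where
  "approximation_set I \<beta> S \<longleftrightarrow>
     S \<subseteq> feasible I \<and> (\<forall>l\<in>Lam I. \<exists>x\<in>S. F I l x \<le> \<beta> * Fopt I l)"

text \<open>
  A problem is a set of instances together with arbitrary binary codes for its instances
  (which may describe \<open>X\<close> and \<open>f\<close> implicitly), for the feasible solutions of each instance,
  and for the numbers that occur as objective values.
\<close>

record ('x, 'p) problem =
  instances :: "('x, 'p) inst set"
  inst_code :: "('x, 'p) inst \<Rightarrow> bool list"
  sol_code :: "('x, 'p) inst \<Rightarrow> 'x \<Rightarrow> bool list"
  num_code :: "real \<Rightarrow> bool list"

definition objective_values :: "('x, 'p::finite) problem \<Rightarrow> real set" where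
  "objective_values P =
     (\<Union>I\<in>instances P. \<Union>x\<in>feasible I.
        insert (snd (objective I x)) (range (\<lambda>i. fst (objective I x) $ i)))"

definition linear_parametric_problem :: "('x, 'p::finite) problem \<Rightarrow> bool" where
  "linear_parametric_problem P \<longleftrightarrow>
     (\<forall>I\<in>instances P. constraints I \<noteq> []) \<and>
     inj_on (inst_code P) (instances P) \<and>
     (\<forall>I\<in>instances P. inj_on (sol_code P I) (feasible I)) \<and>
     inj_on (num_code P) (objective_values P)"

text \<open>As \<open>p\<close> is constant, \<open>f\<close> is polynomial-time computable iff all its components are.\<close>

definition objective_polytime :: "('x, 'p::finite) problem \<Rightarrow> bool" where
  "objective_polytime P \<longleftrightarrow>
     (let D = (SIGMA I:instances P. feasible I);
          inp = (\<lambda>(I, x). pair_code (inst_code P I) (sol_code P I x))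
      in (\<forall>i. polytime_computable D inp (\<lambda>(I, x). num_code P (fst (objective I x) $ i))) \<and>
         polytime_computable D inp (\<lambda>(I, x). num_code P (snd (objective I x))))"

definition Xpol :: "('x, 'p::finite) problem \<Rightarrow> real poly \<Rightarrow> ('x, 'p) inst \<Rightarrow> 'x set" where
  "Xpol P q I = {x\<in>feasible I.
     real (length (sol_code P I x)) \<le> poly q (real (length (inst_code P I)))}"

definition bounded_with_short_optima :: "('x, 'p::finite) problem \<Rightarrow> real poly \<Rightarrow> bool" where
  "bounded_with_short_optima P q \<longleftrightarrow>
     (\<forall>I\<in>instances P. \<forall>l\<in>Lam I.
        bdd_below (F I l ` feasible I) \<and> (\<exists>x\<in>Xpol P q I. optimal_solution I l x))"

definition approximation_oracle ::
  "('x, 'p::finite) problem \<Rightarrow> real poly \<Rightarrow> ('x, 'p) inst \<Rightarrow> real \<Rightarrow> (real ^ 'p \<Rightarrow> 'x) \<Rightarrow> bool" where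
  "approximation_oracle P q I \<alpha> Alg \<longleftrightarrow>
     (\<forall>l\<in>Lam I. Alg l \<in> Xpol P q I \<and> F I l (Alg l) \<le> \<alpha> * Fopt I l)"


section \<open>The algorithm\<close>

definition graph_of :: "('x, 'p::finite) inst \<Rightarrow> 'x \<Rightarrow> ((real ^ 'p) \<times> real) set" where
  "graph_of I x = {(l, z). z = F I l x}"

definition hypograph_of :: "('x, 'p::finite) inst \<Rightarrow> 'x \<Rightarrow> ((real ^ 'p) \<times> real) set" where
  "hypograph_of I x = {(l, z). z \<le> F I l x}"

definition Apoly :: "('x, 'p::finite) inst \<Rightarrow> 'x set \<Rightarrow> ((real ^ 'p) \<times> real) set" where
  "Apoly I S = (\<Inter>x\<in>S. hypograph_of I x) \<inter> (Lam I \<times> UNIV)"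

definition vert :: "'a::real_vector set \<Rightarrow> 'a set" where
  "vert C = {v. v extreme_point_of C}"

definition nonredundant_part :: "('x, 'p::finite) inst \<Rightarrow> 'x set \<Rightarrow> 'x set" where
  "nonredundant_part I S = {x\<in>S. \<exists>C. C facet_of Apoly I S \<and> C \<subseteq> graph_of I x}"

text \<open>
  \<open>Compute V S\<close> is the point just before the vertices are computed, and \<open>Loop W V S\<close> is the
  head of the for-loop, where \<open>W\<close> is the set of vertices not yet treated in the current loop.
  The relation \<open>alg_step\<close> is nondeterministic in the initial parameter, in the order in which
  the loop treats the vertices, and in whether the optional final clean-up is performed.
\<close>

datatype ('x, 'p) alg_state =
    Start
  | Compute "(real ^ 'p) set" "'x set"
  | Loop "((real ^ 'p) \<times> real) set" "(real ^ 'p) set" "'x set"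
  | Return "'x set"

inductive alg_step ::
  "('x, 'p::finite) inst \<Rightarrow> real \<Rightarrow> (real ^ 'p \<Rightarrow> 'x) \<Rightarrow>
   ('x, 'p) alg_state \<Rightarrow> ('x, 'p) alg_state \<Rightarrow> bool"
  for I :: "('x, 'p) inst" and \<epsilon> :: real and Alg :: "real ^ 'p \<Rightarrow> 'x" where
  init: "l0 \<in> Lam I \<Longrightarrow> alg_step I \<epsilon> Alg Start (Compute {l0} {Alg l0})"
| vertices: "alg_step I \<epsilon> Alg (Compute V S) (Loop (vert (Apoly I S)) V S)"
| visited: "(l, z) \<in> W \<Longrightarrow> l \<in> V \<Longrightarrow>
    alg_step I \<epsilon> Alg (Loop W V S) (Loop (W - {(l, z)}) V S)"
| add: "(l, z) \<in> W \<Longrightarrow> l \<notin> V \<Longrightarrow> (1 + \<epsilon>) * F I l (Alg l) < z \<Longrightarrow>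
    alg_step I \<epsilon> Alg (Loop W V S) (Compute (V \<union> {l}) (S \<union> {Alg l}))"
| discard: "(l, z) \<in> W \<Longrightarrow> l \<notin> V \<Longrightarrow> \<not> (1 + \<epsilon>) * F I l (Alg l) < z \<Longrightarrow>
    alg_step I \<epsilon> Alg (Loop W V S) (Loop (W - {(l, z)}) (V \<union> {l}) S)"
| finish: "alg_step I \<epsilon> Alg (Loop {} V S) (Return S)"
| finish_cleanup: "alg_step I \<epsilon> Alg (Loop {} V S) (Return (nonredundant_part I S))"

text \<open>
  Total correctness: no run is infinite, a run can only get stuck by returning a set, and
  every set that can be returned satisfies \<open>R\<close>.
\<close>

definition algorithm_computes ::
  "('x, 'p::finite) inst \<Rightarrow> real \<Rightarrow> (real ^ 'p \<Rightarrow> 'x) \<Rightarrow> ('x set \<Rightarrow> bool) \<Rightarrow> bool" where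
  "algorithm_computes I \<epsilon> Alg R \<longleftrightarrow>
     (\<nexists>\<sigma> :: nat \<Rightarrow> ('x, 'p) alg_state.
        \<sigma> 0 = Start \<and> (\<forall>n. alg_step I \<epsilon> Alg (\<sigma> n) (\<sigma> (Suc n)))) \<and>
     (\<forall>s. (alg_step I \<epsilon> Alg)\<^sup>*\<^sup>* Start s \<longrightarrow>
        (\<exists>s'. alg_step I \<epsilon> Alg s s') \<or> (\<exists>S. s = Return S)) \<and>
     (\<forall>S. (alg_step I \<epsilon> Alg)\<^sup>*\<^sup>* Start (Return S) \<longrightarrow> R S)"

end

theory Submission
  imports Defs
begin

text \<open>
  The set \<open>S\<close> approximates the optimal value from above by the concave function
  \<open>\<lambda>l. min {F l x | x \<in> S}\<close>, whose truncated hypograph is the polyhedron \<open>Apoly I S\<close>.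
  Put \<open>\<beta> = (1 + \<epsilon>) * \<alpha>\<close>.  When the loop ends, every vertex \<open>(l, z)\<close> of this polyhedron satisfies
  \<open>z \<le> (1 + \<epsilon>) * F l (Alg l) \<le> \<beta> * Fopt l\<close>, so for each fixed solution \<open>y\<close> the affine function
  \<open>(l, z) \<mapsto> z - \<beta> * F l y\<close> is nonpositive at all vertices.  As \<open>Lam I\<close> is a polytope, the
  polyhedron recedes only downwards, in a direction in which this function decreases; hence the
  function is maximal at some vertex and is nonpositive everywhere
  (\<open>Apoly_bound_from_vertices\<close>).  Choosing \<open>y\<close> optimal at \<open>l\<close>, and \<open>z\<close> as the minimum over
  \<open>S\<close> at \<open>l\<close>, gives the approximation guarantee at \<open>l\<close>.

  A loop iteration skips a parameter seen before, although the polyhedron may have shrunk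
  meanwhile.  This is harmless: the inequality \<open>z \<le> (1 + \<epsilon>) * F l (Alg l)\<close> is established for
  all \<open>(l, z)\<close> in the polyhedron when \<open>l\<close> is visited, and points only disappear later.

  The clean-up preserves the guarantee because the solutions that define a facet already attain
  the minimum at every parameter (\<open>nonredundant_part_minimizer\<close>): the closed cells on which
  the various solutions are minimal cover the full-dimensional set \<open>Lam I\<close>, and finitely many
  cells with empty interior cannot fill a gap left by the remaining ones.

  Runs are finite because \<open>S\<close> grows strictly with every return to the vertex computation and
  stays inside the finite set of short solutions, while a polyhedron has finitely many vertices.
\<close>

section \<open>The hypograph polyhedron\<close>

lemma F_inner: "F I l x = l \<bullet> fst (objective I x) + snd (objective I x)"
  by (simp add: F_def inner_vec_def)

lemma hypograph_of_halfspace: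
  "hypograph_of I x = {v. (- fst (objective I x), 1) \<bullet> v \<le> snd (objective I x)}"
  by (auto simp: hypograph_of_def F_inner inner_prod_def inner_commute)

lemma graph_of_hyperplane:
  "graph_of I x = {v. (- fst (objective I x), 1) \<bullet> v = snd (objective I x)}"
  by (auto simp: graph_of_def F_inner inner_prod_def inner_commute)

lemma mem_Apoly: "(l, z) \<in> Apoly I S \<longleftrightarrow> l \<in> Lam I \<and> (\<forall>x\<in>S. z \<le> F I l x)"
  by (auto simp: Apoly_def hypograph_of_def)

lemma Apoly_antimono: "S \<subseteq> T \<Longrightarrow> Apoly I T \<subseteq> Apoly I S"
  by (auto simp: Apoly_def)

lemma continuous_on_F [continuous_intros]: "continuous_on A (\<lambda>l. F I l x)"
  unfolding F_inner by (intro continuous_intros)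

lemma satisfies_inner: "satisfies l c \<longleftrightarrow> (\<chi> j. of_rat (fst c $ j)) \<bullet> l \<ge> of_rat (snd c)"
  by (simp add: satisfies_def inner_vec_def)

lemma polyhedron_Apoly:
  assumes "finite S"
  shows "polyhedron (Apoly I S)"
proof -
  let ?row = "\<lambda>c :: (rat^'b) \<times> rat. {v :: (real^'b) \<times> real.
    ((\<chi> j. of_rat (fst c $ j)), 0) \<bullet> v \<ge> of_rat (snd c)}"
  have "Lam I \<times> UNIV = (\<Inter>c\<in>set (constraints I). ?row c)"
    by (auto simp: Lam_def satisfies_inner inner_prod_def set_conv_nth)
  then have "polyhedron (Lam I \<times> (UNIV :: real set))"
    by (auto intro!: polyhedron_Inter polyhedron_halfspace_ge)
  moreover have "polyhedron (\<Inter>x\<in>S. hypograph_of I x)"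
    using assms by (auto simp: hypograph_of_halfspace intro!: polyhedron_Inter polyhedron_halfspace_le)
  ultimately show ?thesis
    unfolding Apoly_def by (rule polyhedron_Int[rotated])
qed

lemma finite_vert_Apoly: "finite S \<Longrightarrow> finite (vert (Apoly I S))"
  unfolding vert_def by (intro finite_polyhedron_extreme_points polyhedron_Apoly)

lemma vert_subset: "vert C \<subseteq> C"
  by (auto simp: vert_def extreme_point_of_def)

text \<open>
  A point below the top of its vertical fibre lies between a higher and a lower point of the
  fibre, so it is not extreme.
\<close>

lemma vert_Apoly_top:
  assumes "(l, z) \<in> vert (Apoly I S)" and "(l, z') \<in> Apoly I S"
  shows "z' \<le> z"
proof (rule ccontr)
  assume "\<not> z' \<le> z"
  then have "z < z'" by simp
  have lz: "(l, z) extreme_point_of Apoly I S" and "(l, z) \<in> Apoly I S"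
    using assms(1) vert_subset by (auto simp: vert_def)
  with \<open>z < z'\<close> have low: "(l, 2 * z - z') \<in> Apoly I S"
    by (fastforce simp: mem_Apoly)
  have "(l, z) = midpoint (l, 2 * z - z') (l, z')"
    by (simp add: midpoint_def scaleR_Pair scaleR_add_left[symmetric] scaleR_2[symmetric])
  moreover have "midpoint (l, 2 * z - z') (l, z') \<in> open_segment (l, 2 * z - z') (l, z')"
    using \<open>z < z'\<close> by simp
  ultimately show False
    using lz low assms(2) unfolding extreme_point_of_def by metis
qed

text \<open>
  Although \<open>Apoly I S\<close> is unbounded, an affine function with positive slope in the last
  coordinate has compact upper level sets on it when \<open>Lam I\<close> is compact.  So it attains its
  maximum, the maximizers form a compact face, and an extreme point of that face is a vertex of
  the polyhedron.
\<close>

lemma Apoly_bound_from_vertices: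
  assumes S: "finite S" "S \<noteq> {}" and comp: "compact (Lam I)"
    and vertices: "\<And>l z. (l, z) \<in> vert (Apoly I S) \<Longrightarrow> z \<le> \<beta> * F I l y"
    and mem: "(l, z) \<in> Apoly I S"
  shows "z \<le> \<beta> * F I l y"
proof -
  obtain x0 where "x0 \<in> S" using S by blast
  \<comment> \<open>Up to an additive constant, the functional \<open>a\<close> is \<open>z - \<beta> * F I l y\<close>.\<close>
  define a where "a = (- (\<beta> *\<^sub>R fst (objective I y)), 1 :: real)"
  have a: "a \<bullet> (m, w) = w - \<beta> * F I m y + \<beta> * snd (objective I y)" for m w
    by (simp add: a_def F_inner inner_commute algebra_simps)
  have closed: "closed (Apoly I S)" and conv: "convex (Apoly I S)"
    using polyhedron_Apoly[OF S(1)] by (auto intro: polyhedron_imp_closed polyhedron_imp_convex)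
  have bdd_above: "bdd_above ((\<lambda>m. F I m x0) ` Lam I)"
    and bdd_below: "bdd_below ((\<lambda>m. \<beta> * F I m y) ` Lam I)"
    by (intro bounded_imp_bdd_above bounded_imp_bdd_below compact_imp_bounded
        compact_continuous_image comp continuous_intros)+
  obtain hi lo where hi: "\<And>m. m \<in> Lam I \<Longrightarrow> F I m x0 \<le> hi"
    and lo: "\<And>m. m \<in> Lam I \<Longrightarrow> lo \<le> \<beta> * F I m y"
    using bdd_above bdd_below unfolding bdd_above_def bdd_below_def by blast
  have compact_level: "compact (Apoly I S \<inter> {v. a \<bullet> v \<ge> c})" for c
  proof -
    have "Apoly I S \<inter> {v. a \<bullet> v \<ge> c} \<subseteq>
        Lam I \<times> {c + lo - \<beta> * snd (objective I y)..hi}"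
    proof
      fix v assume v: "v \<in> Apoly I S \<inter> {v. a \<bullet> v \<ge> c}"
      obtain m w where [simp]: "v = (m, w)" by fastforce
      have "m \<in> Lam I" "w \<le> F I m x0" using v \<open>x0 \<in> S\<close> by (auto simp: mem_Apoly)
      with hi[of m] lo[of m] v show "v \<in> Lam I \<times> {c + lo - \<beta> * snd (objective I y)..hi}"
        by (auto simp: a)
    qed
    moreover have "compact (Lam I \<times> {c + lo - \<beta> * snd (objective I y)..hi})"
      by (intro compact_Times comp compact_Icc)
    ultimately show ?thesis
      using closed_Int[OF closed closed_halfspace_ge, of c a]
      by (meson bounded_subset compact_imp_bounded compact_eq_bounded_closed)
  qed
  define K where "K = Apoly I S \<inter> {v. a \<bullet> v \<ge> a \<bullet> (l, z)}"
  have "compact K" "K \<noteq> {}"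
    using compact_level mem by (auto simp: K_def)
  then obtain v where "v \<in> K" and "\<And>u. u \<in> K \<Longrightarrow> a \<bullet> u \<le> a \<bullet> v"
    using continuous_attains_sup[of K "\<lambda>v. a \<bullet> v"]
      continuous_on_inner[OF continuous_on_const continuous_on_id]
    by blast
  then have v: "v \<in> Apoly I S" and max: "\<And>u. u \<in> Apoly I S \<Longrightarrow> a \<bullet> u \<le> a \<bullet> v"
    by (auto simp: K_def) (smt (verit))
  define T where "T = Apoly I S \<inter> {u. a \<bullet> u = a \<bullet> v}"
  have face: "T face_of Apoly I S"
    unfolding T_def using conv max by (intro face_of_Int_supporting_hyperplane_le) auto
  have "T = Apoly I S \<inter> {u. a \<bullet> u \<ge> a \<bullet> v}"
    unfolding T_def using max by (auto intro: antisym)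
  then have "compact T" using compact_level by simp
  moreover have "convex T" using face face_of_imp_convex by blast
  moreover have "T \<noteq> {}" using v by (auto simp: T_def)
  ultimately obtain e where e: "e extreme_point_of T"
    using extreme_point_exists_convex by blast
  obtain m w where [simp]: "e = (m, w)" by fastforce
  have "(m, w) \<in> vert (Apoly I S)"
    using e face by (simp add: vert_def extreme_point_of_face)
  then have "w \<le> \<beta> * F I m y" by (rule vertices)
  moreover have "a \<bullet> (l, z) \<le> a \<bullet> (m, w)"
    using max[OF mem] e by (auto simp: extreme_point_of_def T_def)
  ultimately show ?thesis by (simp add: a)
qed

section \<open>Facets cover the parameter set\<close>

lemma interior_finite_Union_closed:
  assumes "finite \<C>" and "\<And>C. C \<in> \<C> \<Longrightarrow> closed C \<and> interior C = {}"
  shows "interior (\<Union>\<C>) = {}"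
  using assms
proof (induction rule: finite_induct)
  case (insert C \<C>)
  then show ?case
    using interior_closed_Un_empty_interior[of C "\<Union>\<C>"] by auto
qed simp

text \<open>
  The projection to the parameter space of the face of \<open>Apoly I S\<close> that lies in the graph of
  \<open>x\<close>.
\<close>

definition cell :: "('x, 'p::finite) inst \<Rightarrow> 'x set \<Rightarrow> 'x \<Rightarrow> (real ^ 'p) set" where
  "cell I S x = {l \<in> Lam I. \<forall>y\<in>S. F I l x \<le> F I l y}"

lemma closed_cell:
  assumes "closed (Lam I)"
  shows "closed (cell I S x)"
proof -
  have "cell I S x = Lam I \<inter> (\<Inter>y\<in>S. {l. F I l x \<le> F I l y})"
    by (auto simp: cell_def)
  then show ?thesis
    using assms by (auto intro!: closed_Int closed_INT closed_Collect_le continuous_intros)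
qed

text \<open>
  The face \<open>Apoly I S \<inter> graph_of I x\<close> is an injective affine image of the cell of \<open>x\<close>, hence
  has dimension \<open>p\<close>; a point below it shows that the polyhedron has dimension \<open>p + 1\<close>.
\<close>

lemma full_cell_gives_facet:
  fixes I :: "('x, 'p::finite) inst"
  assumes S: "finite S" "x \<in> S" and int: "interior (cell I S x) \<noteq> {}"
  shows "x \<in> nonredundant_part I S"
proof -
  let ?G = "Apoly I S \<inter> graph_of I x"
  let ?f = "\<lambda>l. (l, l \<bullet> fst (objective I x))"
  have G: "?G = (+) (0, snd (objective I x)) ` ?f ` cell I S x"
    using S(2) by (auto simp: graph_of_def mem_Apoly cell_def F_inner image_iff add.commute)
  have "linear ?f"
    by (auto intro!: linearI simp: inner_add_left)
  moreover have "inj ?f" by (auto intro: injI)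
  ultimately have "aff_dim ?G = aff_dim (cell I S x)"
    unfolding G aff_dim_translation_eq by (rule aff_dim_injective_linear_image)
  also have "\<dots> = int CARD('p)"
    using aff_dim_nonempty_interior[OF int] by simp
  finally have dimG: "aff_dim ?G = int CARD('p)" .
  obtain l where l: "l \<in> cell I S x" using int interior_subset by blast
  have below: "(l, F I l x - 1) \<in> Apoly I S"
    using l by (fastforce simp: cell_def mem_Apoly)
  have "affine hull ?G \<subseteq> graph_of I x"
    unfolding graph_of_hyperplane by (intro hull_minimal affine_hyperplane) auto
  then have "(l, F I l x - 1) \<notin> affine hull ?G"
    by (auto simp: graph_of_def)
  then have "aff_dim (insert (l, F I l x - 1) ?G) = int CARD('p) + 1"
    by (simp add: aff_dim_insert dimG)
  moreover have "aff_dim (insert (l, F I l x - 1) ?G) \<le> aff_dim (Apoly I S)"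
    using below by (intro aff_dim_subset) auto
  moreover have "aff_dim (Apoly I S) \<le> int CARD('p) + 1"
    using aff_dim_le_DIM[of "Apoly I S"] by simp
  ultimately have dimA: "aff_dim (Apoly I S) = int CARD('p) + 1" by simp
  have "?G face_of Apoly I S"
    unfolding graph_of_hyperplane
  proof (rule face_of_Int_supporting_hyperplane_le)
    show "convex (Apoly I S)"
      using polyhedron_Apoly[OF S(1)] by (rule polyhedron_imp_convex)
    show "(- fst (objective I x), 1) \<bullet> v \<le> snd (objective I x)" if "v \<in> Apoly I S" for v
      using that S(2) by (auto simp: Apoly_def hypograph_of_halfspace)
  qed
  moreover have "?G \<noteq> {}" using dimG by auto
  ultimately have "?G facet_of Apoly I S"
    by (simp add: facet_of_def dimG dimA)
  then show ?thesis
    using S(2) by (auto simp: nonredundant_part_def)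
qed

lemma exists_minimizer:
  assumes "finite S" "S \<noteq> {}"
  shows "\<exists>x\<in>S. \<forall>y\<in>S. F I l x \<le> F I l y"
  using arg_min_least[OF assms] arg_min_if_finite(1)[OF assms] by blast

text \<open>
  The cells with nonempty interior cover the interior of \<open>Lam I\<close>, since the other cells
  contribute nothing to the interior of the union.  Their union is closed, and a
  full-dimensional convex set is contained in the closure of its interior.
\<close>

lemma nonredundant_part_minimizer:
  fixes I :: "('x, 'p::finite) inst"
  assumes S: "finite S" "S \<noteq> {}" and Lam: "closed (Lam I)" "convex (Lam I)"
    and dim: "aff_dim (Lam I) = int CARD('p)" and l: "l \<in> Lam I"
  shows "\<exists>x\<in>nonredundant_part I S. \<forall>y\<in>S. F I l x \<le> F I l y"
proof -
  define full where "full = {x\<in>S. interior (cell I S x) \<noteq> {}}"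
  let ?C = "\<Union>x\<in>full. cell I S x" and ?T = "\<Union>x\<in>S - full. cell I S x"
  have closed: "closed ?C"
    using S(1) Lam(1) by (auto simp: full_def intro!: closed_UN closed_cell)
  have "Lam I \<subseteq> ?C \<union> ?T"
  proof
    fix m assume "m \<in> Lam I"
    moreover obtain x where "x \<in> S" "\<forall>y\<in>S. F I m x \<le> F I m y"
      using exists_minimizer[OF S] by blast
    ultimately show "m \<in> ?C \<union> ?T" by (auto simp: cell_def)
  qed
  then have "interior (Lam I) \<subseteq> interior (?C \<union> ?T)" by (rule interior_mono)
  also have "interior ?T = {}"
    using S(1) Lam(1) by (intro interior_finite_Union_closed) (auto simp: full_def closed_cell)
  then have "interior (?C \<union> ?T) = interior ?C"
    using interior_closed_Un_empty_interior closed by blast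
  also have "\<dots> \<subseteq> ?C" by (rule interior_subset)
  finally have int: "interior (Lam I) \<subseteq> ?C" .
  have "affine hull Lam I = UNIV"
    using dim by (simp add: aff_dim_eq_full[symmetric])
  then have "interior (Lam I) \<noteq> {}"
    using rel_interior_interior[of "Lam I"] rel_interior_eq_empty[OF Lam(2)] l by auto
  then have "closure (interior (Lam I)) = closure (Lam I)"
    using Lam(2) by (simp add: convex_closure_interior)
  then have "Lam I \<subseteq> ?C"
    using closure_minimal[OF int closed] closure_subset[of "Lam I"] by blast
  with l obtain x where "x \<in> full" "l \<in> cell I S x" by blast
  then show ?thesis
    using full_cell_gives_facet[OF S(1)] by (auto simp: full_def cell_def)
qed

section \<open>Correctness and termination of the algorithm\<close>

lemma finite_Xpol:
  assumes "inj_on (sol_code P I) (feasible I)"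
  shows "finite (Xpol P q I)"
proof -
  let ?n = "nat \<lfloor>poly q (real (length (inst_code P I)))\<rfloor>"
  have "sol_code P I ` Xpol P q I \<subseteq> {w. set w \<subseteq> UNIV \<and> length w \<le> ?n}"
    by (auto simp: Xpol_def le_nat_floor)
  then have "finite (sol_code P I ` Xpol P q I)"
    by (rule finite_subset) (intro finite_lists_length_le finite)
  moreover have "inj_on (sol_code P I) (Xpol P q I)"
    using assms by (rule inj_on_subset) (auto simp: Xpol_def)
  ultimately show ?thesis by (rule finite_imageD)
qed

text \<open>
  The facts about one instance on which the correctness argument rests; \<open>X\<close> is a finite pool
  of solutions that contains all answers of the oracle.  The assumption \<open>scaling\<close> is where
  nonnegativity of the objective enters: it says that the value of a solution can
  only grow under multiplication by \<open>1 + \<epsilon>\<close>, and it is trivial for \<open>\<epsilon> = 0\<close>.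
\<close>

locale outer_approximation =
  fixes I :: "('x, 'p::finite) inst" and \<epsilon> \<alpha> :: real and Alg :: "real ^ 'p \<Rightarrow> 'x"
    and X :: "'x set"
  assumes compact_Lam: "compact (Lam I)" and convex_Lam: "convex (Lam I)"
    and full_dim: "aff_dim (Lam I) = int CARD('p)"
    and finite_X: "finite X" and X_feasible: "X \<subseteq> feasible I"
    and bounded_below: "l \<in> Lam I \<Longrightarrow> bdd_below (F I l ` feasible I)"
    and has_optimum: "l \<in> Lam I \<Longrightarrow> \<exists>x. optimal_solution I l x"
    and Alg_mem: "l \<in> Lam I \<Longrightarrow> Alg l \<in> X"
    and Alg_approx: "l \<in> Lam I \<Longrightarrow> F I l (Alg l) \<le> \<alpha> * Fopt I l"
    and eps_nonneg: "\<epsilon> \<ge> 0"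
    and scaling: "l \<in> Lam I \<Longrightarrow> x \<in> feasible I \<Longrightarrow> F I l x \<le> (1 + \<epsilon>) * F I l x"
    and alpha_nonneg: "\<alpha> \<ge> 0"
begin

text \<open>
  The bound at visited parameters is demanded for all points of the polyhedron above them, not
  for vertices only.  In this form it survives every extension of \<open>S\<close>, which can turn a
  different point above the same parameter into a vertex.
\<close>

definition sound :: "(real ^ 'p) set \<Rightarrow> 'x set \<Rightarrow> bool" where
  "sound V S \<longleftrightarrow> V \<subseteq> Lam I \<and> S \<subseteq> X \<and> S \<noteq> {} \<and>
     (\<forall>l\<in>V. \<forall>z. (l, z) \<in> Apoly I S \<longrightarrow> z \<le> (1 + \<epsilon>) * F I l (Alg l))"

fun invariant :: "('x, 'p) alg_state \<Rightarrow> bool" where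
  "invariant Start = True"
| "invariant (Compute V S) = sound V S"
| "invariant (Loop W V S) =
    (sound V S \<and> W \<subseteq> vert (Apoly I S) \<and> fst ` (vert (Apoly I S) - W) \<subseteq> V)"
| "invariant (Return S) = approximation_set I ((1 + \<epsilon>) * \<alpha>) S"

lemma Fopt_le: "l \<in> Lam I \<Longrightarrow> x \<in> feasible I \<Longrightarrow> Fopt I l \<le> F I l x"
  unfolding Fopt_def by (intro cINF_lower bounded_below)

lemma optimal_eq_Fopt:
  assumes "optimal_solution I l x"
  shows "F I l x = Fopt I l"
  using assms unfolding Fopt_def optimal_solution_def
  by (intro cInf_eq_minimum[symmetric]) auto

lemma sound_finite: "sound V S \<Longrightarrow> finite S"
  using finite_subset[OF _ finite_X] by (simp add: sound_def)

text \<open>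
  The set \<open>T\<close> stands for what is returned: \<open>S\<close> itself or what the clean-up leaves of it.
\<close>

lemma finished_approximation_set:
  assumes sound: "sound V S" and treated: "fst ` vert (Apoly I S) \<subseteq> V" and sub: "T \<subseteq> S"
    and min: "\<And>l. l \<in> Lam I \<Longrightarrow> \<exists>x\<in>T. \<forall>y\<in>S. F I l x \<le> F I l y"
  shows "approximation_set I ((1 + \<epsilon>) * \<alpha>) T"
  unfolding approximation_set_def
proof (intro conjI ballI)
  show "T \<subseteq> feasible I"
    using sub sound X_feasible by (auto simp: sound_def)
next
  fix l assume l: "l \<in> Lam I"
  obtain x where x: "x \<in> T" "\<forall>y\<in>S. F I l x \<le> F I l y" using min[OF l] by blast
  obtain y where y: "optimal_solution I l y" using has_optimum[OF l] by blast
  have "F I l x \<le> (1 + \<epsilon>) * \<alpha> * F I l y"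
  proof (rule Apoly_bound_from_vertices[where S = S])
    show "finite S" "S \<noteq> {}" using sound sound_finite[OF sound] by (auto simp: sound_def)
    show "compact (Lam I)" by (rule compact_Lam)
    show "(l, F I l x) \<in> Apoly I S" using l x by (simp add: mem_Apoly)
  next
    fix m z assume v: "(m, z) \<in> vert (Apoly I S)"
    then have "(m, z) \<in> Apoly I S" using vert_subset by blast
    moreover have "m \<in> V" using imageI[OF v, of fst] treated by auto
    ultimately have m: "m \<in> Lam I" and "z \<le> (1 + \<epsilon>) * F I m (Alg m)"
      using sound by (auto simp: sound_def)
    note this(2)
    also have "(1 + \<epsilon>) * F I m (Alg m) \<le> (1 + \<epsilon>) * (\<alpha> * Fopt I m)"
      using Alg_approx[OF m] eps_nonneg by (intro mult_left_mono) auto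
    also have "\<dots> \<le> (1 + \<epsilon>) * (\<alpha> * F I m y)"
      using Fopt_le[OF m] y eps_nonneg alpha_nonneg
      by (intro mult_left_mono) (auto simp: optimal_solution_def)
    finally show "z \<le> (1 + \<epsilon>) * \<alpha> * F I m y" by (simp add: mult.assoc)
  qed
  then show "\<exists>x\<in>T. F I l x \<le> (1 + \<epsilon>) * \<alpha> * Fopt I l"
    using x(1) optimal_eq_Fopt[OF y] by auto
qed

text \<open>
  Once \<open>Alg l\<close> belongs to the set, the polyhedron lies below its graph, which gives the bound at
  the new parameter \<open>l\<close>.  The case of empty sets serves the initialization.
\<close>

lemma sound_insert_Alg:
  assumes "V = {} \<and> S = {} \<or> sound V S" and l: "l \<in> Lam I"
  shows "sound (V \<union> {l}) (S \<union> {Alg l})"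
proof -
  have "z \<le> (1 + \<epsilon>) * F I l (Alg l)" if "(l, z) \<in> Apoly I (S \<union> {Alg l})" for z
    using that scaling[OF l, of "Alg l"] Alg_mem[OF l] X_feasible by (auto simp: mem_Apoly)
  moreover have "Apoly I (S \<union> {Alg l}) \<subseteq> Apoly I S"
    by (intro Apoly_antimono) auto
  ultimately show ?thesis
    using assms Alg_mem[OF l] unfolding sound_def by blast
qed

lemma loop_vertex_in_Lam:
  assumes "invariant (Loop W V S)" "(l, z) \<in> W"
  shows "l \<in> Lam I"
  using assms vert_subset[of "Apoly I S"] by (auto simp: mem_Apoly)

lemma invariant_step:
  assumes "alg_step I \<epsilon> Alg s s'" and "invariant s"
  shows "invariant s'"
  using assms
proof cases
  case (init l0)
  then show ?thesis using sound_insert_Alg[of "{}" "{}" l0] by simp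
next
  case (add l z W V S)
  then show ?thesis using sound_insert_Alg[of V S l] loop_vertex_in_Lam[of W V S l z] assms(2) by simp
next
  case (discard l z W V S)
  have "l \<in> Lam I" "(l, z) \<in> vert (Apoly I S)"
    using loop_vertex_in_Lam[of W V S l z] assms(2) discard by auto
  \<comment> \<open>The failed test bounds the vertex, which is the highest point above \<open>l\<close>.\<close>
  then have "w \<le> (1 + \<epsilon>) * F I l (Alg l)" if "(l, w) \<in> Apoly I S" for w
    using vert_Apoly_top[OF _ that] discard by fastforce
  then show ?thesis
    using assms(2) discard \<open>l \<in> Lam I\<close> by (auto simp: sound_def)
next
  case (finish V S)
  then show ?thesis
    using assms(2) finished_approximation_set[of V S S] exists_minimizer[of S I] sound_finite
    by (auto simp: sound_def)
next
  case (finish_cleanup V S)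
  have "\<exists>x\<in>nonredundant_part I S. \<forall>y\<in>S. F I l x \<le> F I l y" if "l \<in> Lam I" for l
    using finish_cleanup assms(2) sound_finite[of V S] that compact_Lam convex_Lam full_dim
    by (intro nonredundant_part_minimizer) (auto simp: sound_def compact_imp_closed)
  then show ?thesis
    using assms(2) finish_cleanup
    by (auto intro!: finished_approximation_set[of V S] simp: nonredundant_part_def)
qed auto

text \<open>
  A lexicographic termination measure.  The factor 2 makes room for the passage from
  \<open>Compute\<close> to \<open>Loop\<close>, which leaves \<open>S\<close> unchanged, between two increases of \<open>S\<close>.
\<close>

fun progress :: "('x, 'p) alg_state \<Rightarrow> nat \<times> nat" where
  "progress Start = (2 * card X + 3, 0)"
| "progress (Compute V S) = (2 * (card X - card S) + 2, 0)"
| "progress (Loop W V S) = (2 * (card X - card S) + 1, card W)"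
| "progress (Return S) = (0, 0)"

lemma finite_loop_set: "invariant (Loop W V S) \<Longrightarrow> finite W"
  by (auto intro: finite_subset[OF _ finite_vert_Apoly[OF sound_finite]])

text \<open>
  The essential case is \<open>add\<close>: the polyhedron lies below the graphs of all members of \<open>S\<close>, so
  an oracle answer that lies strictly below the vertex after scaling cannot be one of them.
\<close>

lemma progress_decreases:
  assumes "alg_step I \<epsilon> Alg s s'" and "invariant s"
  shows "(progress s', progress s) \<in> less_than <*lex*> less_than"
  using assms
proof cases
  case (visited l z W V S)
  then show ?thesis using card_Diff1_less[of W "(l, z)"] finite_loop_set assms(2) by simp
next
  case (discard l z W V S)
  then show ?thesis using card_Diff1_less[of W "(l, z)"] finite_loop_set assms(2) by simp
next
  case (add l z W V S)
  have "invariant (Loop W V S)" using assms(2) add by simp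
  then have l: "l \<in> Lam I" and S: "S \<subseteq> X" "finite S" and "(l, z) \<in> vert (Apoly I S)"
    using loop_vertex_in_Lam[of W V S l z] add(3) sound_finite
    by (auto simp: sound_def)
  then have z: "(l, z) \<in> Apoly I S" using vert_subset by blast
  have "Alg l \<notin> S"
  proof
    assume "Alg l \<in> S"
    then have "z \<le> F I l (Alg l)" using z by (simp add: mem_Apoly)
    also have "\<dots> \<le> (1 + \<epsilon>) * F I l (Alg l)"
      using scaling[OF l] Alg_mem[OF l] X_feasible by blast
    finally show False using add by simp
  qed
  then have "card (S \<union> {Alg l}) = Suc (card S)" using S by simp
  moreover have "card (S \<union> {Alg l}) \<le> card X"
    using S Alg_mem[OF l] finite_X by (intro card_mono) auto
  ultimately have "card X - card S = Suc (card X - card (S \<union> {Alg l}))" by simp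
  then show ?thesis using add by simp
qed auto

lemma invariant_reachable:
  assumes "(alg_step I \<epsilon> Alg)\<^sup>*\<^sup>* Start s"
  shows "invariant s"
  using assms by (induction rule: rtranclp_induct) (auto intro: invariant_step)

lemma step_or_return: "(\<exists>s'. alg_step I \<epsilon> Alg s s') \<or> (\<exists>S. s = Return S)"
proof (cases s)
  case Start
  have "Lam I \<noteq> {}" using full_dim by auto
  then show ?thesis using Start alg_step.init by blast
next
  case (Compute V S)
  then show ?thesis using alg_step.vertices by blast
next
  case (Loop W V S)
  show ?thesis
  proof (cases "W = {}")
    case True
    then show ?thesis using Loop alg_step.finish by blast
  next
    case False
    then obtain l z where "(l, z) \<in> W" by fastforce
    then show ?thesis
      using Loop alg_step.visited alg_step.add alg_step.discard by metis
  qed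
qed simp

lemma algorithm_correct:
  "algorithm_computes I \<epsilon> Alg (approximation_set I ((1 + \<epsilon>) * \<alpha>))"
  unfolding algorithm_computes_def
proof (intro conjI allI impI)
  show "\<nexists>\<sigma>. \<sigma> 0 = Start \<and> (\<forall>n. alg_step I \<epsilon> Alg (\<sigma> n) (\<sigma> (Suc n)))"
  proof
    assume "\<exists>\<sigma>. \<sigma> 0 = Start \<and> (\<forall>n. alg_step I \<epsilon> Alg (\<sigma> n) (\<sigma> (Suc n)))"
    then obtain \<sigma> where \<sigma>: "\<sigma> 0 = Start" "\<And>n. alg_step I \<epsilon> Alg (\<sigma> n) (\<sigma> (Suc n))" by blast
    have "invariant (\<sigma> n)" for n
      by (induction n) (use \<sigma> invariant_step in auto)
    then have "\<forall>n. (progress (\<sigma> (Suc n)), progress (\<sigma> n)) \<in> less_than <*lex*> less_than"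
      using \<sigma>(2) progress_decreases by blast
    moreover have "wf (less_than <*lex*> less_than)" by blast
    ultimately show False
      using wf_no_infinite_down_chainE[of _ "\<lambda>n. progress (\<sigma> n)"] by blast
  qed
next
  fix s
  show "(\<exists>s'. alg_step I \<epsilon> Alg s s') \<or> (\<exists>S. s = Return S)" by (rule step_or_return)
next
  fix S assume "(alg_step I \<epsilon> Alg)\<^sup>*\<^sup>* Start (Return S)"
  then show "approximation_set I ((1 + \<epsilon>) * \<alpha>) S"
    using invariant_reachable by fastforce
qed

end

theorem theorem1:
  fixes P :: "('x, 'p::finite) problem" and I :: "('x, 'p) inst"
    and q :: "real poly" and \<epsilon> \<alpha> :: real and Alg :: "real ^ 'p \<Rightarrow> 'x"
  assumes "linear_parametric_problem P"
    and "objective_polytime P"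
    and "bounded_with_short_optima P q"
    and "I \<in> instances P"
    and "aff_dim (Lam I) = int CARD('p)"
    and "irredundant I"
    and "polytope (Lam I)"
    and "\<epsilon> \<ge> 0" and "\<alpha> \<ge> 1"
    and "(1 + \<epsilon>) * \<alpha> > 1 \<Longrightarrow> \<forall>l\<in>Lam I. \<forall>x\<in>feasible I. F I l x \<ge> 0"
    and "approximation_oracle P q I \<alpha> Alg"
  shows "algorithm_computes I \<epsilon> Alg (approximation_set I ((1 + \<epsilon>) * \<alpha>))"
proof -
  have scaling: "F I l x \<le> (1 + \<epsilon>) * F I l x" if "l \<in> Lam I" "x \<in> feasible I" for l x
  proof (cases "\<epsilon> = 0")
    case False
    then have "1 < 1 + \<epsilon>" using assms(8) by simp
    also have "1 + \<epsilon> \<le> (1 + \<epsilon>) * \<alpha>"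
      using mult_left_mono[of 1 \<alpha> "1 + \<epsilon>"] assms(8,9) by simp
    finally have "F I l x \<ge> 0" using assms(10) that by blast
    then show ?thesis using assms(8) by (simp add: algebra_simps)
  qed simp
  interpret outer_approximation I \<epsilon> \<alpha> Alg "Xpol P q I"
  proof
    show "compact (Lam I)" "convex (Lam I)"
      using assms(7) by (auto intro: polytope_imp_compact polytope_imp_convex)
    show "finite (Xpol P q I)"
      using assms(1,4) by (intro finite_Xpol) (auto simp: linear_parametric_problem_def)
    show "Xpol P q I \<subseteq> feasible I" by (auto simp: Xpol_def)
    show "bdd_below (F I l ` feasible I)" if "l \<in> Lam I" for l
      using assms(3,4) that by (auto simp: bounded_with_short_optima_def)
    show "\<exists>x. optimal_solution I l x" if "l \<in> Lam I" for l
      using assms(3,4) that by (auto simp: bounded_with_short_optima_def)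
    show "Alg l \<in> Xpol P q I" "F I l (Alg l) \<le> \<alpha> * Fopt I l" if "l \<in> Lam I" for l
      using assms(11) that by (auto simp: approximation_oracle_def)
  qed (use assms scaling in auto)
  show ?thesis by (rule algorithm_correct)
qed

end
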